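(* Let $G$ be a connected graph on $n$ vertices, and let $t\ge 1$ be an integer. Then $$\mu_G([n+t,\partial^{L}_1(G)])\le n-c(\overline{G}).$$ Consequently, if $\chi=\chi(G)$ and $\ell_1\ge\ell_2\ge\cdots\ge\ell_\chi$ are the color-class sizes in a fixed proper coloring of $G$ with exactly $\chi$ color classes, then for every integer $t\ge 2$, $$A_t\le\mu_G([n+t,\partial^{L}_1(G)])\le n-c(\overline{G}),\qquad\text{where } A_t=\sum_{\substack{1\le j\le\chi\\ \ell_j\ge t}}(\ell_j-1).$$
   Context: Graphs are finite, simple and undirected. For a connected graph $G$ with vertices $v_1,\dots,v_n$, let $d_G(u,v)$ be the length of a shortest $u$–$v$ path, $D(G)=(d_G(v_i,v_j))_{i,j}$ the distance matrix, and $\operatorname{Tr}_G(v)=\sum_{u\in V(G)}d_G(u,v)$ the transmission of $v$. The distance Laplacian matrix is $\mathcal{D}^{L}(G)=\operatorname{diag}(\operatorname{Tr}_G(v_1),\dots,\operatorname{Tr}_G(v_n))-D(G)$, a real symmetric positive semidefinite matrix with $\mathcal{D}^{L}(G)\mathbf 1=\mathbf 0$. Its eigenvalues, listed with multiplicity, are ordered $\partial^{L}_1(G)\ge\partial^{L}_2(G)\ge\cdots\ge\partial^{L}_n(G)=0$. For a real interval $I$, $\mu_G(I)$ is the number of eigenvalues of $\mathcal{D}^{L}(G)$ in $I$, counted with multiplicity (an interval $[a,b]$ with $a>b$ is empty). $\overline{G}$ is the complement graph of $G$ and $c(\overline{G})$ its number of connected components. A proper coloring is a partition of $V(G)$ into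 nonempty independent sets (color classes); $\chi(G)$ is the least number of classes. *)

theory Defs
  imports
    "Graph_Theory.Graph_Theory"
    "Jordan_Normal_Form.Char_Poly"
    "HOL-Library.Disjoint_Sets"
begin

text \<open>
  A finite simple undirected graph is a \<^locale>\<open>pair_graph\<close>, that is, a finite symmetric loop-free
  digraph without parallel arcs: each edge \<open>uv\<close> is represented by the two arcs \<open>(u, v)\<close> and \<open>(v, u)\<close>.
\<close>

definition graph_dist :: "'a pair_pre_digraph \<Rightarrow> 'a \<Rightarrow> 'a \<Rightarrow> nat" where
  "graph_dist G u v = (LEAST k. \<exists>p. pre_digraph.apath (with_proj G) u p v \<and> length p = k)"

definition transmission :: "'a pair_pre_digraph \<Rightarrow> 'a \<Rightarrow> nat" where
  "transmission G v = (\<Sum>u\<in>pverts G. graph_dist G u v)"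

text \<open>In the following definitions, \<open>vs\<close> is the enumeration \<open>v\<^sub>1, \<dots>, v\<^sub>n\<close> of the vertices.\<close>

definition distance_matrix :: "'a pair_pre_digraph \<Rightarrow> 'a list \<Rightarrow> real mat" where
  "distance_matrix G vs =
    mat (length vs) (length vs) (\<lambda>(i, j). real (graph_dist G (vs ! i) (vs ! j)))"

definition distance_laplacian :: "'a pair_pre_digraph \<Rightarrow> 'a list \<Rightarrow> real mat" where
  "distance_laplacian G vs =
    mat_diag (length vs) (\<lambda>i. real (transmission G (vs ! i))) - distance_matrix G vs"

text \<open>
  Eigenvalues are taken in the reals, with their multiplicities as roots of the characteristic
  polynomial. As the matrix is real symmetric, these are all \<open>n\<close> eigenvalues.
\<close>

definition dl_eigenvalues :: "'a pair_pre_digraph \<Rightarrow> 'a list \<Rightarrow> real multiset" where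
  "dl_eigenvalues G vs = proots (char_poly (distance_laplacian G vs))"

text \<open>The index \<open>i\<close> is 1-based: \<open>dl_eigenvalue G vs 1\<close> is the largest eigenvalue.\<close>

definition dl_eigenvalue :: "'a pair_pre_digraph \<Rightarrow> 'a list \<Rightarrow> nat \<Rightarrow> real" where
  "dl_eigenvalue G vs i = rev (sorted_list_of_multiset (dl_eigenvalues G vs)) ! (i - 1)"

definition dl_count :: "'a pair_pre_digraph \<Rightarrow> 'a list \<Rightarrow> real set \<Rightarrow> nat" where
  "dl_count G vs I = size {# x \<in># dl_eigenvalues G vs. x \<in> I #}"

definition complement_graph :: "'a pair_pre_digraph \<Rightarrow> 'a pair_pre_digraph" where
  "complement_graph G =
    \<lparr> pverts = pverts G,
      parcs = {(u, v). u \<in> pverts G \<and> v \<in> pverts G \<and> u \<noteq> v \<and> (u, v) \<notin> parcs G} \<rparr>"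

text \<open>In a symmetric digraph the strongly connected components are the connected components.\<close>

definition num_components :: "'a pair_pre_digraph \<Rightarrow> nat" where
  "num_components G = card (pre_digraph.sccs (with_proj G))"

definition independent_set :: "'a pair_pre_digraph \<Rightarrow> 'a set \<Rightarrow> bool" where
  "independent_set G S \<longleftrightarrow> S \<subseteq> pverts G \<and> (\<forall>u\<in>S. \<forall>v\<in>S. (u, v) \<notin> parcs G)"

definition proper_coloring :: "'a pair_pre_digraph \<Rightarrow> 'a set set \<Rightarrow> bool" where
  "proper_coloring G P \<longleftrightarrow> partition_on (pverts G) P \<and> (\<forall>S\<in>P. independent_set G S)"

definition chromatic_number :: "'a pair_pre_digraph \<Rightarrow> nat" where
  "chromatic_number G = (LEAST k. \<exists>P. proper_coloring G P \<and> card P = k)"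

end

theory Submission
  imports Defs "Jordan_Normal_Form.Spectral_Radius"
begin

text \<open>
  Write \<open>d\<close> for the distance in \<open>G\<close> and \<open>n\<close> for the number of vertices. The quadratic form of the
  distance Laplacian is \<open>Q(x) = 1/2 \<Sum>\<^sub>u \<Sum>\<^sub>v d(u, v) (x u - x v)\<^sup>2\<close>, and replacing every distance by \<open>1\<close>
  turns it into \<open>n \<parallel>x\<parallel>\<^sup>2 - (\<Sum>\<^sub>v x v)\<^sup>2\<close>. Both bounds compare these two forms on a suitable subspace
  and then count dimensions as in the Courant-Fischer theorem.

  Upper bound: vertices in different components of the complement are adjacent in \<open>G\<close>. If \<open>x\<close> is
  constant on these components, every pair with \<open>x u \<noteq> x v\<close> therefore has distance \<open>1\<close>, so
  \<open>Q(x) \<le> n \<parallel>x\<parallel>\<^sup>2\<close>. Such \<open>x\<close> form a space of dimension \<open>c\<close>, the number of components, which leaves room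
  for at most \<open>n - c\<close> eigenvalues above \<open>n\<close>.

  Lower bound: take \<open>x\<close> supported on the color classes with at least \<open>t\<close> vertices and with sum \<open>0\<close> on each
  of them. Distinct vertices of one class \<open>S\<close> have distance at least \<open>2\<close>, so \<open>Q(x)\<close> exceeds \<open>n \<parallel>x\<parallel>\<^sup>2\<close> by at
  least the form of the complete graph on each \<open>S\<close>, which is \<open>|S|\<close> times the squared norm of \<open>x\<close> on \<open>S\<close>.
  Hence \<open>Q(x) \<ge> (n + t) \<parallel>x\<parallel>\<^sup>2\<close> on a space whose dimension is the sum of all \<open>|S| - 1\<close>, so at least that many
  eigenvalues are \<open>\<ge> n + t\<close>.

  The subspaces are never given by bases: a subspace is a finite set of linear equations on \<open>x\<close>, and
  \<open>few_large_eigenvalues\<close> and \<open>many_large_eigenvalues\<close> only count these equations. They rest on the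
  spectral theorem for real symmetric matrices (\<open>real_symmetric_diagonalization\<close>), which also ensures
  that the real roots of the characteristic polynomial are \<open>n\<close> in number.
\<close>

section \<open>Diagonalization of real symmetric matrices\<close>

text \<open>
  Over the complex numbers some eigenvalue exists; comparing \<open>\<langle>A v, v\<rangle>\<close> with \<open>\<langle>v, A v\<rangle>\<close> shows that
  it is real, hence it is already a root of the real characteristic polynomial.
\<close>

lemma real_symmetric_has_eigenvector:
  fixes A :: "real mat"
  assumes A: "A \<in> carrier_mat n n" and sym: "A\<^sup>T = A" and n: "n > 0"
  shows "\<exists>v e. v \<in> carrier_vec n \<and> v \<noteq> 0\<^sub>v n \<and> A *\<^sub>v v = e \<cdot>\<^sub>v v"
proof -
  define C where "C = map_mat complex_of_real A"
  have C: "C \<in> carrier_mat n n" using A by (simp add: C_def)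
  have symC: "C\<^sup>T = C" unfolding C_def by (metis map_mat_transpose sym)
  from spectrum_non_empty[OF C n] obtain k where k: "eigenvalue C k"
    unfolding spectrum_def by auto
  then obtain v where v: "v \<in> carrier_vec n" "v \<noteq> 0\<^sub>v n" "C *\<^sub>v v = k \<cdot>\<^sub>v v"
    using C unfolding eigenvalue_def eigenvector_def by auto
  have conjC: "C *\<^sub>v conjugate v = conjugate (C *\<^sub>v v)"
    using C v(1) by (intro eq_vecI) (auto simp: C_def scalar_prod_def)
  have "k * (v \<bullet>c v) = (C *\<^sub>v v) \<bullet>c v"
    using v by (simp add: v(3))
  also have "\<dots> = v \<bullet> (C *\<^sub>v conjugate v)"
    using transpose_vec_mult_scalar[OF C, of "conjugate v" v] v symC by auto
  also have "\<dots> = cnj k * (v \<bullet>c v)"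
    unfolding conjC v(3) using v(1) by (simp add: conjugate_smult_vec)
  finally have "k = cnj k"
    using v(1,2) by simp
  then obtain e where e: "k = complex_of_real e"
    by (metis Reals_cases Reals_cnj_iff)
  have "poly (char_poly C) k = 0"
    using k eigenvalue_root_char_poly[OF C] by simp
  moreover have "char_poly C = map_poly complex_of_real (char_poly A)"
    unfolding C_def by (rule of_real_hom.char_poly_hom[OF A])
  ultimately have "poly (char_poly A) e = 0"
    unfolding e by simp
  then have "eigenvalue A e" using eigenvalue_root_char_poly[OF A] by simp
  then show ?thesis using A unfolding eigenvalue_def eigenvector_def by auto
qed

text \<open>
  The reflection in the hyperplane orthogonal to \<open>w = u - e\<^sub>0\<close> exchanges the unit vectors \<open>e\<^sub>0\<close> and \<open>u\<close>.
  It extends \<open>u\<close> to an orthonormal basis by an explicit formula.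
\<close>

lemma householder_reflection:
  fixes u :: "real vec"
  assumes u: "u \<in> carrier_vec n" and unit: "u \<bullet> u = 1" and n: "n > 0"
  shows "\<exists>H \<in> carrier_mat n n. H\<^sup>T = H \<and> H * H = 1\<^sub>m n \<and> col H 0 = u"
proof -
  define w where "w i = u $ i - (if i = 0 then 1 else 0)" for i
  define s where "s = (\<Sum>k<n. w k * w k)"
  define c where "c = 2 / s"
  define H where "H = mat n n (\<lambda>(i, j). (if i = j then 1 else 0) - c * (w i * w j))"
  have u1: "(\<Sum>k<n. u $ k * u $ k) = 1"
    using unit u by (simp add: scalar_prod_def atLeast0LessThan)
  have "s = (\<Sum>k<n. u $ k * u $ k - (if k = 0 then 2 * u $ 0 - 1 else 0))"
    unfolding s_def w_def by (rule sum.cong) (auto simp: algebra_simps)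
  then have s: "s = 2 - 2 * u $ 0"
    using n u1 by (simp add: sum_subtractf)
  \<comment> \<open>For \<open>u = e\<^sub>0\<close> the division by \<open>s = 0\<close> gives \<open>c = 0\<close>, so that \<open>H\<close> is the identity, as it should be.\<close>
  have cs: "c * (c * s) = 2 * c"
    by (simp add: c_def)
  have "H * H = 1\<^sub>m n"
  proof (rule eq_matI)
    fix i j assume "i < dim_row (1\<^sub>m n)" "j < dim_col (1\<^sub>m n)"
    then have ij: "i < n" "j < n" by auto
    have "(H * H) $$ (i, j) = (\<Sum>k<n. ((if i = k then 1 else 0) - c * (w i * w k)) *
        ((if k = j then 1 else 0) - c * (w k * w j)))"
      using ij by (simp add: H_def scalar_prod_def atLeast0LessThan)
    also have "\<dots> = (\<Sum>k<n. (if k = i then (if i = j then 1 else 0) - c * (w i * w j) else 0)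
        - (if k = j then c * (w i * w j) else 0) + c * c * w i * w j * (w k * w k))"
      by (rule sum.cong) (auto simp: algebra_simps)
    also have "\<dots> = (if i = j then 1 else 0) - 2 * c * (w i * w j) + c * (c * s) * (w i * w j)"
      using ij by (simp add: sum.distrib sum_subtractf flip: sum_distrib_left s_def)
    also have "\<dots> = 1\<^sub>m n $$ (i, j)"
      using ij by (simp add: cs)
    finally show "(H * H) $$ (i, j) = 1\<^sub>m n $$ (i, j)" .
  qed (auto simp: H_def)
  moreover have "col H 0 = u"
  proof (rule eq_vecI)
    fix i assume "i < dim_vec u"
    then have i: "i < n" using u by simp
    have "c * w 0 * w i = - w i"
    proof (cases "s = 0")
      case True
      then have "w i * w i = 0"
        using i sum_nonneg_eq_0_iff[of "{..<n}" "\<lambda>k. w k * w k"] by (simp add: s_def)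
      then show ?thesis by simp
    next
      case False
      then show ?thesis by (simp add: c_def w_def s field_simps)
    qed
    then show "col H 0 $ i = u $ i"
      using i n by (auto simp: H_def w_def algebra_simps)
  qed (use u in \<open>simp add: H_def\<close>)
  moreover have "H\<^sup>T = H"
    by (rule eq_matI) (auto simp: H_def)
  ultimately show ?thesis
    by (intro bexI[of _ H]) (auto simp: H_def)
qed

text \<open>
  A symmetric matrix whose first basis vector is an eigenvector also preserves the orthogonal
  complement of that vector.
\<close>

lemma symmetric_mat_block:
  fixes B :: "real mat"
  assumes B: "B \<in> carrier_mat (Suc m) (Suc m)" and sym: "B\<^sup>T = B"
    and c: "col B 0 = e \<cdot>\<^sub>v unit_vec (Suc m) 0"
  obtains B' where "B' \<in> carrier_mat m m" "B'\<^sup>T = B'"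
    "B = four_block_mat (mat 1 1 (\<lambda>_. e)) (0\<^sub>m 1 m) (0\<^sub>m m 1) B'"
proof
  define B' where "B' = mat m m (\<lambda>(i, j). B $$ (Suc i, Suc j))"
  have swap: "B $$ (i, j) = B $$ (j, i)" if "i < Suc m" "j < Suc m" for i j
    using that B sym by (metis carrier_matD index_transpose_mat(1))
  have c0: "B $$ (i, 0) = (if i = 0 then e else 0)" if "i < Suc m" for i
    using arg_cong[OF c, of "\<lambda>v. v $ i"] that B by auto
  show "B' \<in> carrier_mat m m" by (simp add: B'_def)
  show "B'\<^sup>T = B'" by (rule eq_matI) (auto simp: B'_def swap)
  show "B = four_block_mat (mat 1 1 (\<lambda>_. e)) (0\<^sub>m 1 m) (0\<^sub>m m 1) B'"
    by (rule eq_matI) (use B c0 swap in \<open>auto simp: B'_def four_block_mat_def Let_def\<close>)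
qed

text \<open>
  A reflection moves a unit eigenvector to the first coordinate, where it splits off as a block of
  size one; the induction hypothesis diagonalizes the other block.
\<close>

lemma real_symmetric_diagonalization:
  fixes A :: "real mat"
  assumes "A \<in> carrier_mat n n" and "A\<^sup>T = A"
  shows "\<exists>P e. P \<in> carrier_mat n n \<and> P\<^sup>T * P = 1\<^sub>m n \<and> P\<^sup>T * (A * P) = mat_diag n e"
  using assms
proof (induction n arbitrary: A)
  case 0
  then show ?case by (intro exI[of _ A] exI[of _ "\<lambda>_. 0"]) (auto intro!: eq_matI simp: mat_diag_def)
next
  case (Suc m)
  let ?n = "Suc m"
  note A = Suc.prems(1)
  obtain v e where v: "v \<in> carrier_vec ?n" "v \<noteq> 0\<^sub>v ?n" "A *\<^sub>v v = e \<cdot>\<^sub>v v"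
    using real_symmetric_has_eigenvector[OF Suc.prems] by auto
  define u where "u = (1 / sqrt (v \<bullet> v)) \<cdot>\<^sub>v v"
  have u: "u \<in> carrier_vec ?n" using v by (simp add: u_def)
  have "v \<bullet> v > 0"
    using conjugate_square_greater_0_vec[OF v(1)] v(2) by (simp add: conjugate_vec_def vec_eq_iff)
  then have "u \<bullet> u = 1" using v(1)
    by (simp add: u_def flip: real_sqrt_mult)
  moreover have Au: "A *\<^sub>v u = e \<cdot>\<^sub>v u"
    using A v by (simp add: u_def mult_mat_vec smult_smult_assoc mult.commute)
  ultimately obtain H where H: "H \<in> carrier_mat ?n ?n" "H\<^sup>T = H" "H * H = 1\<^sub>m ?n" "col H 0 = u"
    using householder_reflection[OF u] by auto
  define B where "B = H * (A * H)"
  have B: "B \<in> carrier_mat ?n ?n" using A H by (simp add: B_def)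
  have symB: "B\<^sup>T = B"
    using A H Suc.prems(2) by (simp add: B_def transpose_mult[of _ ?n ?n _ ?n])
  have "col B 0 = H *\<^sub>v (A *\<^sub>v u)"
    using col_mult2[OF H(1) mult_carrier_mat[OF A H(1)], of 0] col_mult2[OF A H(1), of 0] H(4)
    by (simp only: B_def zero_less_Suc)
  also have "\<dots> = e \<cdot>\<^sub>v (H *\<^sub>v col H 0)"
    using H u by (simp add: Au mult_mat_vec)
  also have "H *\<^sub>v col H 0 = col (H * H) 0"
    using col_mult2[OF H(1,1), of 0] by (simp only: zero_less_Suc)
  finally have "col B 0 = e \<cdot>\<^sub>v unit_vec ?n 0"
    by (simp add: H(3))
  from symmetric_mat_block[OF B symB this]
  obtain B' where B': "B' \<in> carrier_mat m m" "B'\<^sup>T = B'"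
    "B = four_block_mat (mat 1 1 (\<lambda>_. e)) (0\<^sub>m 1 m) (0\<^sub>m m 1) B'" .
  from Suc.IH[OF B'(1,2)] obtain P' e' where
    P': "P' \<in> carrier_mat m m" "P'\<^sup>T * P' = 1\<^sub>m m" "P'\<^sup>T * (B' * P') = mat_diag m e'" by auto
  define F where "F = four_block_mat (1\<^sub>m 1) (0\<^sub>m 1 m) (0\<^sub>m m 1) P'"
  have F: "F \<in> carrier_mat ?n ?n" using P' by (auto simp: F_def)
  have FT: "F\<^sup>T = four_block_mat (1\<^sub>m 1) (0\<^sub>m 1 m) (0\<^sub>m m 1) P'\<^sup>T"
    unfolding F_def by (subst transpose_four_block_mat[OF _ _ _ P'(1)]) auto
  have FF: "F\<^sup>T * F = 1\<^sub>m ?n"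
    unfolding FT unfolding F_def
    by (subst mult_four_block_mat[of _ 1 1 _ m _ m _ _ 1 _ m])
       (use P' in \<open>auto intro!: eq_matI simp: four_block_mat_def\<close>)
  have BF: "B * F = four_block_mat (mat 1 1 (\<lambda>_. e)) (0\<^sub>m 1 m) (0\<^sub>m m 1) (B' * P')"
    unfolding B'(3) F_def
    by (subst mult_four_block_mat[of _ 1 1 _ m _ m _ _ 1 _ m])
       (use P' B' in \<open>auto intro!: cong_four_block_mat\<close>)
  have "F\<^sup>T * (B * F) = four_block_mat (mat 1 1 (\<lambda>_. e)) (0\<^sub>m 1 m) (0\<^sub>m m 1) (mat_diag m e')"
    unfolding FT BF
    by (subst mult_four_block_mat[of _ 1 1 _ m _ m _ _ 1 _ m])
       (use P' B' in \<open>auto intro!: cong_four_block_mat\<close>)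
  also have "\<dots> = mat_diag ?n (\<lambda>i. if i = 0 then e else e' (i - 1))"
    by (rule eq_matI) (auto simp: mat_diag_def four_block_mat_def Let_def)
  finally have D: "F\<^sup>T * (B * F) = mat_diag ?n (\<lambda>i. if i = 0 then e else e' (i - 1))" .
  note assoc = assoc_mult_mat[of _ ?n ?n _ ?n _ ?n]
  have T: "(H * F)\<^sup>T = F\<^sup>T * H"
    using H F by (simp add: transpose_mult[of _ ?n ?n _ ?n])
  have "(H * F)\<^sup>T * (H * F) = F\<^sup>T * ((H * H) * F)"
    using H(1) F unfolding T by (simp add: assoc)
  then have "(H * F)\<^sup>T * (H * F) = 1\<^sub>m ?n"
    using F FF H(3) by simp
  moreover have "(H * F)\<^sup>T * (A * (H * F)) = F\<^sup>T * (B * F)"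
    using H(1) F A unfolding T B_def by (simp add: assoc)
  ultimately show ?case
    using H(1) F D by (intro exI[of _ "H * F"]) auto
qed

text \<open>
  The diagonalization read as a statement about the quadratic form: in the coordinates
  \<open>q k \<bullet> x\<close> it is a combination of squares weighted by the eigenvalues, and the norm is unchanged.
\<close>

lemma spectral_decomposition:
  fixes A :: "real mat"
  assumes A: "A \<in> carrier_mat n n" and sym: "A\<^sup>T = A"
  shows "\<exists>q e. proots (char_poly A) = image_mset e (mset_set {..<n}) \<and>
    (\<forall>k. q k \<in> carrier_vec n) \<and>
    (\<forall>x \<in> carrier_vec n. x \<bullet> (A *\<^sub>v x) = (\<Sum>k<n. e k * (q k \<bullet> x)\<^sup>2) \<and>
      x \<bullet> x = (\<Sum>k<n. (q k \<bullet> x)\<^sup>2))"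
proof -
  obtain P e where P: "P \<in> carrier_mat n n" "P\<^sup>T * P = 1\<^sub>m n" "P\<^sup>T * (A * P) = mat_diag n e"
    using real_symmetric_diagonalization[OF A sym] by auto
  let ?D = "mat_diag n e"
  have PT: "P\<^sup>T \<in> carrier_mat n n" using P by simp
  have PPT: "P * P\<^sup>T = 1\<^sub>m n"
    by (rule mat_mult_left_right_inverse[OF PT P(1,2)])
  note assoc = assoc_mult_mat[of _ n n _ n _ n]
  have "P * ?D * P\<^sup>T = (P * P\<^sup>T) * (A * (P * P\<^sup>T))"
    using A P(1) PT by (simp add: P(3)[symmetric] assoc)
  then have "A = P * ?D * P\<^sup>T"
    using A by (simp add: PPT)
  then have "similar_mat A ?D"
    using A P(1) PT P(2) PPT by (intro similar_matI[of _ _ P "P\<^sup>T" n]) auto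
  then have "char_poly A = char_poly ?D" by (rule char_poly_similar)
  also have "\<dots> = (\<Prod>a\<leftarrow>diag_mat ?D. [:- a, 1:])"
    by (rule char_poly_upper_triangular[of _ n]) (auto simp: mat_diag_def)
  also have "diag_mat ?D = map e [0..<n]"
    by (auto simp: diag_mat_def mat_diag_def)
  finally have cp: "char_poly A = (\<Prod>a\<leftarrow>map e [0..<n]. [:- a, 1:])" .
  have "proots (\<Prod>a\<leftarrow>xs. [:- a, 1:]) = mset xs" for xs :: "real list"
  proof (induction xs)
    case (Cons a xs)
    have "(\<Prod>a\<leftarrow>xs. [:- a, 1:]) \<noteq> 0"
      by (auto simp: prod_list_zero_iff)
    then show ?case
      using proots_mult[of "[:- a, 1:]" "\<Prod>a\<leftarrow>xs. [:- a, 1:]"] Cons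
      by (simp del: mult_pCons_left)
  qed simp
  then have "proots (char_poly A) = mset (map e [0..<n])"
    unfolding cp .
  then have roots: "proots (char_poly A) = image_mset e (mset_set {..<n})"
    by (simp add: atLeast0LessThan)
  have forms: "x \<bullet> (A *\<^sub>v x) = (\<Sum>k<n. e k * (col P k \<bullet> x)\<^sup>2) \<and>
      x \<bullet> x = (\<Sum>k<n. (col P k \<bullet> x)\<^sup>2)" if x: "x \<in> carrier_vec n" for x
  proof -
    define y where "y = P\<^sup>T *\<^sub>v x"
    have y: "y \<in> carrier_vec n" using PT x by (simp add: y_def)
    have yk: "y $ k = col P k \<bullet> x" if "k < n" for k
      using that P by (simp add: y_def)
    have xy: "x = P *\<^sub>v y"
      using P PT x by (simp add: y_def PPT flip: assoc_mult_mat_vec)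
    have "x \<bullet> x = (P\<^sup>T *\<^sub>v x) \<bullet> y"
      by (subst (2) xy) (rule transpose_vec_mult_scalar[OF P(1) y x, symmetric])
    then have 1: "x \<bullet> x = y \<bullet> y" by (simp add: y_def)
    have Ax: "A *\<^sub>v x \<in> carrier_vec n" using A x by simp
    have "x \<bullet> (A *\<^sub>v x) = (A *\<^sub>v x) \<bullet> (P *\<^sub>v y)"
      using comm_scalar_prod[OF x Ax] by (simp flip: xy)
    also have "\<dots> = (P\<^sup>T *\<^sub>v (A *\<^sub>v x)) \<bullet> y"
      by (rule transpose_vec_mult_scalar[OF P(1) y Ax, symmetric])
    also have "P\<^sup>T *\<^sub>v (A *\<^sub>v x) = ?D *\<^sub>v y"
      unfolding P(3)[symmetric] xy
      using A P(1) PT y by (simp add: assoc_mult_mat_vec[of _ n n _ n])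
    finally have 2: "x \<bullet> (A *\<^sub>v x) = (?D *\<^sub>v y) \<bullet> y" .
    have Dy: "(?D *\<^sub>v y) $ k = e k * y $ k" if "k < n" for k
    proof -
      have "(?D *\<^sub>v y) $ k = (\<Sum>j<n. if k = j then e j * y $ j else 0)"
        using that y
        by (simp add: mat_diag_def scalar_prod_def atLeast0LessThan if_distrib[of "\<lambda>c. c * _"]
            cong: if_cong)
      then show ?thesis using that by simp
    qed
    have "(?D *\<^sub>v y) \<bullet> y = (\<Sum>k<n. (?D *\<^sub>v y) $ k * y $ k)"
      using y by (simp only: scalar_prod_def carrier_vecD atLeast0LessThan)
    also have "\<dots> = (\<Sum>k<n. e k * (col P k \<bullet> x)\<^sup>2)"
      by (rule sum.cong) (simp_all only: lessThan_iff Dy yk power2_eq_square mult.assoc)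
    finally have 3: "(?D *\<^sub>v y) \<bullet> y = (\<Sum>k<n. e k * (col P k \<bullet> x)\<^sup>2)" .
    have "y \<bullet> y = (\<Sum>k<n. y $ k * y $ k)"
      using y by (simp only: scalar_prod_def carrier_vecD atLeast0LessThan)
    also have "\<dots> = (\<Sum>k<n. (col P k \<bullet> x)\<^sup>2)"
      by (rule sum.cong) (simp_all only: lessThan_iff yk power2_eq_square)
    finally show ?thesis using 1 2 3 by simp
  qed
  have "\<forall>k. col P k \<in> carrier_vec n" using P by auto
  then show ?thesis using roots forms by blast
qed

section \<open>Counting eigenvalues by linear equations\<close>

text \<open>
  Zero rows fill the coefficient matrix up to a square one, which is singular.
\<close>

lemma homogeneous_system_nontrivial_solution:
  fixes a :: "'i \<Rightarrow> 'j \<Rightarrow> real"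
  assumes I: "finite I" and J: "finite J" and less: "card I < card J"
  shows "\<exists>z. (\<exists>j\<in>J. z j \<noteq> 0) \<and> (\<forall>i\<in>I. (\<Sum>j\<in>J. a i j * z j) = 0)"
proof -
  define N where "N = card J"
  obtain g where g: "bij_betw g {..<N} J"
    using ex_bij_betw_nat_finite[OF J] unfolding N_def atLeast0LessThan by blast
  obtain h where h: "bij_betw h {..<card I} I"
    using ex_bij_betw_nat_finite[OF I] unfolding atLeast0LessThan by blast
  define M where "M = mat N N (\<lambda>(r, c). if r < card I then a (h r) (g c) else 0)"
  have M: "M \<in> carrier_mat N N" by (simp add: M_def)
  have N: "card I < N" using less by (simp add: N_def)
  have "M\<^sup>T *\<^sub>v unit_vec N (card I) = 0\<^sub>v N"
    by (rule eq_vecI) (use N in \<open>auto simp: M_def\<close>)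
  moreover have "unit_vec N (card I) \<noteq> (0\<^sub>v N :: real vec)"
    using unit_vec_nonzero[OF N] .
  ultimately have "det M\<^sup>T = 0"
    using det_0_iff_vec_prod_zero[of "M\<^sup>T" N] M unit_vec_carrier[of N "card I"]
    unfolding transpose_carrier_mat by blast
  then have "det M = 0" using det_transpose[OF M] by simp
  then obtain v where v: "v \<in> carrier_vec N" "v \<noteq> 0\<^sub>v N" "M *\<^sub>v v = 0\<^sub>v N"
    using det_0_iff_vec_prod_zero[OF M] by blast
  define z where "z j = v $ the_inv_into {..<N} g j" for j
  have zg: "z (g c) = v $ c" if "c < N" for c
    using that g by (simp add: z_def the_inv_into_f_f bij_betw_def)
  have "(\<Sum>j\<in>J. a i j * z j) = 0" if "i \<in> I" for i
  proof -
    have "i \<in> h ` {..<card I}"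
      using that bij_betw_imp_surj_on[OF h] by simp
    then obtain r where r: "r < card I" "i = h r" by auto
    have "(\<Sum>j\<in>J. a i j * z j) = (\<Sum>c<N. a i (g c) * v $ c)"
      unfolding sum.reindex_bij_betw[OF g, of "\<lambda>j. a i j * z j", symmetric]
      by (rule sum.cong) (simp_all only: lessThan_iff zg)
    also have "\<dots> = (M *\<^sub>v v) $ r"
      using r N v(1) by (simp add: M_def scalar_prod_def atLeast0LessThan)
    finally show ?thesis using r N v(3) by simp
  qed
  moreover have "\<exists>c<N. v $ c \<noteq> 0"
  proof (rule ccontr)
    assume "\<not> ?thesis"
    then have "v = 0\<^sub>v N" using v(1) by (intro eq_vecI) auto
    then show False using v(2) by simp
  qed
  then obtain c where c: "c < N" "v $ c \<noteq> 0" by blast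
  then have "\<exists>j\<in>J. z j \<noteq> 0"
    using g by (intro bexI[of _ "g c"]) (auto simp: zg bij_betw_def)
  ultimately show ?thesis by (intro exI[of _ z]) simp
qed

definition form_matrix :: "('a \<Rightarrow> 'a \<Rightarrow> real) \<Rightarrow> 'a list \<Rightarrow> real mat" where
  "form_matrix M vs = mat (length vs) (length vs) (\<lambda>(i, j). M (vs ! i) (vs ! j))"

text \<open>
  The same decomposition for functions on the vertices, so that the enumeration \<open>vs\<close> is needed
  only for the matrix.
\<close>

lemma spectral_decomposition_form:
  assumes vs: "distinct vs" and sym: "\<And>u v. M u v = M v u"
  defines "n \<equiv> length vs"
  shows "\<exists>q e. proots (char_poly (form_matrix M vs)) = image_mset e (mset_set {..<n}) \<and>
    (\<forall>x. (\<Sum>u\<in>set vs. \<Sum>v\<in>set vs. M u v * x u * x v) = 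
            (\<Sum>k<n. e k * (\<Sum>v\<in>set vs. q k v * x v)\<^sup>2) \<and>
         (\<Sum>v\<in>set vs. (x v)\<^sup>2) = (\<Sum>k<n. (\<Sum>v\<in>set vs. q k v * x v)\<^sup>2))"
proof -
  let ?A = "form_matrix M vs"
  have A: "?A \<in> carrier_mat n n" by (simp add: form_matrix_def n_def)
  have symA: "?A\<^sup>T = ?A" by (rule eq_matI) (auto simp: form_matrix_def sym)
  have bij: "bij_betw ((!) vs) {..<n} (set vs)"
    unfolding n_def by (rule bij_betw_nth[OF vs]) auto
  define idx where "idx = the_inv_into {..<n} ((!) vs)"
  have idx: "idx (vs ! i) = i" if "i < n" for i
    using that bij by (simp add: idx_def the_inv_into_f_f bij_betw_def)
  have reindex: "(\<Sum>v\<in>set vs. f v) = (\<Sum>i<n. f (vs ! i))" for f :: "'a \<Rightarrow> real"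
    by (rule sum.reindex_bij_betw[OF bij, symmetric])
  obtain q e where qe: "proots (char_poly ?A) = image_mset e (mset_set {..<n})"
    "\<And>k. q k \<in> carrier_vec n"
    "\<And>x. x \<in> carrier_vec n \<Longrightarrow> x \<bullet> (?A *\<^sub>v x) = (\<Sum>k<n. e k * (q k \<bullet> x)\<^sup>2)"
    "\<And>x. x \<in> carrier_vec n \<Longrightarrow> x \<bullet> x = (\<Sum>k<n. (q k \<bullet> x)\<^sup>2)"
    using spectral_decomposition[OF A symA] by auto
  have "(\<Sum>u\<in>set vs. \<Sum>v\<in>set vs. M u v * x u * x v) = 
            (\<Sum>k<n. e k * (\<Sum>v\<in>set vs. q k $ idx v * x v)\<^sup>2) \<and>
         (\<Sum>v\<in>set vs. (x v)\<^sup>2) = (\<Sum>k<n. (\<Sum>v\<in>set vs. q k $ idx v * x v)\<^sup>2)" for x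
  proof -
    define y where "y = vec n (\<lambda>i. x (vs ! i))"
    have y: "y \<in> carrier_vec n" by (simp add: y_def)
    have qy: "q k \<bullet> y = (\<Sum>v\<in>set vs. q k $ idx v * x v)" for k
      unfolding reindex by (simp add: scalar_prod_def y_def atLeast0LessThan idx)
    have "y \<bullet> (?A *\<^sub>v y) = (\<Sum>u\<in>set vs. \<Sum>v\<in>set vs. M u v * x u * x v)"
      unfolding reindex using A
      by (simp add: scalar_prod_def y_def form_matrix_def atLeast0LessThan sum_distrib_left
          mult_ac flip: n_def)
    moreover have "y \<bullet> y = (\<Sum>v\<in>set vs. (x v)\<^sup>2)"
      unfolding reindex by (simp add: scalar_prod_def y_def atLeast0LessThan power2_eq_square)
    ultimately show ?thesis
      using qe(3,4)[OF y] by (simp add: qy)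
  qed
  then show ?thesis
    using qe(1) by (intro exI[of _ "\<lambda>k v. q k $ idx v"] exI[of _ e]) blast
qed

lemma size_filter_image_mset_set:
  "finite K \<Longrightarrow> size (filter_mset P (image_mset e (mset_set K))) = card {k\<in>K. P (e k)}"
  by (simp add: filter_mset_image_mset)

text \<open>
  One half of the Courant-Fischer principle. If more than \<open>card I\<close> eigenvalues were \<open>\<ge> s\<close>, then the equations
  indexed by \<open>I\<close>, together with the vanishing of the coordinates that belong to the eigenvalues below \<open>s\<close>,
  would be fewer than the unknowns. On a nonzero solution the form would be at least
  \<open>s\<close> times the squared norm, and also at most \<open>r\<close> times it.
\<close>

lemma few_large_eigenvalues:
  fixes a :: "'i \<Rightarrow> 'a \<Rightarrow> real"
  assumes vs: "distinct vs" and sym: "\<And>u v. M u v = M v u" and I: "finite I"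
    and bound: "\<And>x. (\<forall>i\<in>I. (\<Sum>v\<in>set vs. a i v * x v) = 0) \<Longrightarrow>
      (\<Sum>u\<in>set vs. \<Sum>v\<in>set vs. M u v * x u * x v) \<le> r * (\<Sum>v\<in>set vs. (x v)\<^sup>2)"
    and less: "r < s"
  shows "size {#x \<in># proots (char_poly (form_matrix M vs)). s \<le> x#} \<le> card I"
proof (rule ccontr)
  assume many: "\<not> ?thesis"
  define n where "n = length vs"
  obtain q e where qe: "proots (char_poly (form_matrix M vs)) = image_mset e (mset_set {..<n})"
    "\<And>x. (\<Sum>u\<in>set vs. \<Sum>v\<in>set vs. M u v * x u * x v) =
            (\<Sum>k<n. e k * (\<Sum>v\<in>set vs. q k v * x v)\<^sup>2)"
    "\<And>x. (\<Sum>v\<in>set vs. (x v)\<^sup>2) = (\<Sum>k<n. (\<Sum>v\<in>set vs. q k v * x v)\<^sup>2)"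
    using spectral_decomposition_form[of vs M, OF vs sym] unfolding n_def by blast
  define K where "K = {k\<in>{..<n}. \<not> s \<le> e k}"
  have "{k\<in>{..<n}. s \<le> e k} \<union> K = {..<n}" by (auto simp: K_def)
  then have "card {k\<in>{..<n}. s \<le> e k} + card K = n"
    using card_Un_disjoint[of "{k\<in>{..<n}. s \<le> e k}" K] by (simp add: K_def disjoint_iff)
  then have "card (I <+> K) < card (set vs)"
    using many I vs
    by (simp add: qe(1) size_filter_image_mset_set card_Plus K_def distinct_card flip: n_def)
  moreover have "finite (I <+> K)" using I by (simp add: K_def)
  ultimately have "\<exists>x. (\<exists>v\<in>set vs. x v \<noteq> 0) \<and>
      (\<forall>j \<in> I <+> K. (\<Sum>v\<in>set vs. case_sum a q j v * x v) = 0)"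
    by (intro homogeneous_system_nontrivial_solution) simp_all
  then obtain x where x: "\<exists>v\<in>set vs. x v \<noteq> 0"
    and *: "\<forall>j \<in> I <+> K. (\<Sum>v\<in>set vs. case_sum a q j v * x v) = 0"
    by (elim exE conjE)
  have xI: "(\<Sum>v\<in>set vs. a i v * x v) = 0" if "i \<in> I" for i
    using bspec[OF *, OF InlI[OF that]] by simp
  have xK: "(\<Sum>v\<in>set vs. q k v * x v) = 0" if "k \<in> K" for k
    using bspec[OF *, OF InrI[OF that]] by simp
  define y where "y k = (\<Sum>v\<in>set vs. q k v * x v)" for k
  have "s * (\<Sum>v\<in>set vs. (x v)\<^sup>2) \<le> (\<Sum>u\<in>set vs. \<Sum>v\<in>set vs. M u v * x u * x v)"
    unfolding qe(2,3) sum_distrib_left y_def[symmetric]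
  proof (rule sum_mono)
    fix k assume "k \<in> {..<n}"
    then show "s * (y k)\<^sup>2 \<le> e k * (y k)\<^sup>2"
      using xK[of k] by (cases "k \<in> K") (auto simp: K_def y_def intro!: mult_right_mono)
  qed
  also have "\<dots> \<le> r * (\<Sum>v\<in>set vs. (x v)\<^sup>2)"
    by (rule bound) (use xI in blast)
  finally have "s * (\<Sum>v\<in>set vs. (x v)\<^sup>2) \<le> r * (\<Sum>v\<in>set vs. (x v)\<^sup>2)" .
  moreover have "(\<Sum>v\<in>set vs. (x v)\<^sup>2) > 0"
    using x by (auto intro!: sum_pos2)
  ultimately show False using less by simp
qed

text \<open>
  The other half: this time the coordinates that belong to the eigenvalues \<open>\<ge> s\<close> are set to zero.
\<close>

lemma many_large_eigenvalues:
  fixes a :: "'i \<Rightarrow> 'a \<Rightarrow> real"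
  assumes vs: "distinct vs" and sym: "\<And>u v. M u v = M v u" and I: "finite I"
    and bound: "\<And>x. (\<forall>i\<in>I. (\<Sum>v\<in>set vs. a i v * x v) = 0) \<Longrightarrow>
      s * (\<Sum>v\<in>set vs. (x v)\<^sup>2) \<le> (\<Sum>u\<in>set vs. \<Sum>v\<in>set vs. M u v * x u * x v)"
  shows "length vs \<le> card I + size {#x \<in># proots (char_poly (form_matrix M vs)). s \<le> x#}"
proof (rule ccontr)
  assume few: "\<not> ?thesis"
  define n where "n = length vs"
  obtain q e where qe: "proots (char_poly (form_matrix M vs)) = image_mset e (mset_set {..<n})"
    "\<And>x. (\<Sum>u\<in>set vs. \<Sum>v\<in>set vs. M u v * x u * x v) =
            (\<Sum>k<n. e k * (\<Sum>v\<in>set vs. q k v * x v)\<^sup>2)"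
    "\<And>x. (\<Sum>v\<in>set vs. (x v)\<^sup>2) = (\<Sum>k<n. (\<Sum>v\<in>set vs. q k v * x v)\<^sup>2)"
    using spectral_decomposition_form[of vs M, OF vs sym] unfolding n_def by blast
  define K where "K = {k\<in>{..<n}. s \<le> e k}"
  have "card (I <+> K) < card (set vs)"
    using few I vs
    by (simp add: qe(1) size_filter_image_mset_set card_Plus K_def distinct_card flip: n_def)
  moreover have "finite (I <+> K)" using I by (simp add: K_def)
  ultimately have "\<exists>x. (\<exists>v\<in>set vs. x v \<noteq> 0) \<and>
      (\<forall>j \<in> I <+> K. (\<Sum>v\<in>set vs. case_sum a q j v * x v) = 0)"
    by (intro homogeneous_system_nontrivial_solution) simp_all
  then obtain x where x: "\<exists>v\<in>set vs. x v \<noteq> 0"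
    and *: "\<forall>j \<in> I <+> K. (\<Sum>v\<in>set vs. case_sum a q j v * x v) = 0"
    by (elim exE conjE)
  have xI: "(\<Sum>v\<in>set vs. a i v * x v) = 0" if "i \<in> I" for i
    using bspec[OF *, OF InlI[OF that]] by simp
  have xK: "(\<Sum>v\<in>set vs. q k v * x v) = 0" if "k \<in> K" for k
    using bspec[OF *, OF InrI[OF that]] by simp
  define y where "y k = (\<Sum>v\<in>set vs. q k v * x v)" for k
  have pos: "(\<Sum>v\<in>set vs. (x v)\<^sup>2) > 0"
    using x by (auto intro!: sum_pos2)
  have "\<exists>k<n. y k \<noteq> 0"
  proof (rule ccontr)
    assume "\<not> ?thesis"
    then show False using pos unfolding qe(3) y_def[symmetric] by simp
  qed
  then obtain k where k: "k < n" "y k \<noteq> 0" by blast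
  have "(\<Sum>u\<in>set vs. \<Sum>v\<in>set vs. M u v * x u * x v) < s * (\<Sum>v\<in>set vs. (x v)\<^sup>2)"
    unfolding qe(2,3) sum_distrib_left y_def[symmetric]
  proof (rule sum_strict_mono_ex1)
    show "\<forall>k\<in>{..<n}. e k * (y k)\<^sup>2 \<le> s * (y k)\<^sup>2"
    proof
      fix k assume "k \<in> {..<n}"
      then show "e k * (y k)\<^sup>2 \<le> s * (y k)\<^sup>2"
        using xK[of k] by (cases "k \<in> K") (auto simp: K_def y_def intro!: mult_right_mono)
    qed
    have "e k < s" using k xK[of k] by (fastforce simp: K_def y_def)
    then show "\<exists>k\<in>{..<n}. e k * (y k)\<^sup>2 < s * (y k)\<^sup>2"
      using k by (intro bexI[of _ k]) auto
  qed auto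
  then show False using bound[of x] xI by fastforce
qed

section \<open>Quadratic forms of weighted Laplacians\<close>

lemma laplacian_quadratic_form:
  fixes d :: "'a \<Rightarrow> 'a \<Rightarrow> real"
  assumes V: "finite V" and sym: "\<And>u v. d u v = d v u"
  shows "(\<Sum>u\<in>V. \<Sum>v\<in>V. ((if u = v then \<Sum>w\<in>V. d w u else 0) - d u v) * x u * x v) =
    (\<Sum>u\<in>V. \<Sum>v\<in>V. d u v * (x u - x v)\<^sup>2) / 2"
proof -
  have "(\<Sum>u\<in>V. \<Sum>v\<in>V. ((if u = v then \<Sum>w\<in>V. d w u else 0) - d u v) * x u * x v) =
      (\<Sum>u\<in>V. \<Sum>v\<in>V. if u = v then (\<Sum>w\<in>V. d w u) * (x u)\<^sup>2 else 0) -
      (\<Sum>u\<in>V. \<Sum>v\<in>V. d u v * x u * x v)"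
    unfolding sum_subtractf[symmetric]
    by (intro sum.cong refl) (auto simp: algebra_simps power2_eq_square)
  also have "(\<Sum>u\<in>V. \<Sum>v\<in>V. if u = v then (\<Sum>w\<in>V. d w u) * (x u)\<^sup>2 else 0) =
      (\<Sum>u\<in>V. \<Sum>v\<in>V. d u v * (x u)\<^sup>2)"
  proof (rule sum.cong[OF refl])
    fix u assume u: "u \<in> V"
    have "(\<Sum>w\<in>V. d w u) = (\<Sum>v\<in>V. d u v)" by (simp only: sym)
    then show "(\<Sum>v\<in>V. if u = v then (\<Sum>w\<in>V. d w u) * (x u)\<^sup>2 else 0) =
        (\<Sum>v\<in>V. d u v * (x u)\<^sup>2)"
      using V u by (simp add: sum_distrib_right)
  qed
  finally have 1: "(\<Sum>u\<in>V. \<Sum>v\<in>V. ((if u = v then \<Sum>w\<in>V. d w u else 0) - d u v) * x u * x v) =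
      (\<Sum>u\<in>V. \<Sum>v\<in>V. d u v * (x u)\<^sup>2) - (\<Sum>u\<in>V. \<Sum>v\<in>V. d u v * x u * x v)" .
  have 2: "(\<Sum>u\<in>V. \<Sum>v\<in>V. d u v * (x v)\<^sup>2) = (\<Sum>u\<in>V. \<Sum>v\<in>V. d u v * (x u)\<^sup>2)"
    by (subst sum.swap) (simp only: sym)
  have "(\<Sum>u\<in>V. \<Sum>v\<in>V. d u v * (x u - x v)\<^sup>2) = (\<Sum>u\<in>V. \<Sum>v\<in>V. d u v * (x u)\<^sup>2) +
      (\<Sum>u\<in>V. \<Sum>v\<in>V. d u v * (x v)\<^sup>2) - 2 * (\<Sum>u\<in>V. \<Sum>v\<in>V. d u v * x u * x v)"
    unfolding sum_distrib_left sum.distrib[symmetric] sum_subtractf[symmetric]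
    by (intro sum.cong refl) (simp add: power2_eq_square algebra_simps)
  then show ?thesis unfolding 1 2 by simp
qed

lemma sum_squared_differences:
  fixes x :: "'a \<Rightarrow> real"
  shows "(\<Sum>u\<in>V. \<Sum>v\<in>V. (x u - x v)\<^sup>2) = 2 * (card V * (\<Sum>v\<in>V. (x v)\<^sup>2) - (\<Sum>v\<in>V. x v)\<^sup>2)"
proof -
  have "(\<Sum>u\<in>V. \<Sum>v\<in>V. (x u - x v)\<^sup>2) =
      (\<Sum>u\<in>V. \<Sum>v\<in>V. (x u)\<^sup>2) + (\<Sum>u\<in>V. \<Sum>v\<in>V. (x v)\<^sup>2) - 2 * (\<Sum>u\<in>V. \<Sum>v\<in>V. x u * x v)"
    unfolding sum_distrib_left sum.distrib[symmetric] sum_subtractf[symmetric]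
    by (intro sum.cong refl) (simp add: power2_eq_square algebra_simps)
  also have "(\<Sum>u\<in>V. \<Sum>v\<in>V. x u * x v) = (\<Sum>v\<in>V. x v)\<^sup>2"
    by (simp add: power2_eq_square sum_product)
  also have "(\<Sum>u\<in>V. \<Sum>v\<in>V. (x u)\<^sup>2) = card V * (\<Sum>v\<in>V. (x v)\<^sup>2)"
    by (simp flip: sum_distrib_left)
  also have "(\<Sum>u\<in>V. \<Sum>v\<in>V. (x v)\<^sup>2) = card V * (\<Sum>v\<in>V. (x v)\<^sup>2)"
    by simp
  finally show ?thesis by simp
qed

text \<open>
  The estimate behind the lower bound. Each pair of vertices contributes at least the weight \<open>1\<close>, and a
  pair inside a member of \<open>B\<close> at least one more. As \<open>x\<close> has sum \<open>0\<close> on all of \<open>V\<close> and on each member, the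
  first part adds up to \<open>card V\<close> times the squared norm and the second to at least \<open>t\<close> times it.
\<close>

lemma form_on_independent_classes:
  fixes d :: "'a \<Rightarrow> 'a \<Rightarrow> real" and x :: "'a \<Rightarrow> real" and t :: nat
  assumes V: "finite V" and B: "disjoint B" "\<And>S. S \<in> B \<Longrightarrow> S \<subseteq> V"
    and d1: "\<And>u v. u \<in> V \<Longrightarrow> v \<in> V \<Longrightarrow> u \<noteq> v \<Longrightarrow> 1 \<le> d u v"
    and d2: "\<And>S u v. S \<in> B \<Longrightarrow> u \<in> S \<Longrightarrow> v \<in> S \<Longrightarrow> u \<noteq> v \<Longrightarrow> 2 \<le> d u v"
    and size: "\<And>S. S \<in> B \<Longrightarrow> t \<le> card S"
    and supp: "\<And>v. v \<in> V - \<Union>B \<Longrightarrow> x v = 0"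
    and zero: "\<And>S. S \<in> B \<Longrightarrow> (\<Sum>v\<in>S. x v) = 0"
  shows "(card V + t) * (\<Sum>v\<in>V. (x v)\<^sup>2) \<le> (\<Sum>u\<in>V. \<Sum>v\<in>V. d u v * (x u - x v)\<^sup>2) / 2"
proof -
  let ?f = "\<lambda>S u v. if u \<in> S \<and> v \<in> S then (x u - x v)\<^sup>2 else 0"
  have "B \<subseteq> Pow V" using B(2) by auto
  then have finB: "finite B" using V by (simp add: finite_subset)
  have finS: "finite S" if "S \<in> B" for S by (rule finite_subset[OF B(2)[OF that] V])
  have "(\<Union>B) \<subseteq> V" using B(2) by blast
  have over_B: "(\<Sum>v\<in>V. g v) = (\<Sum>S\<in>B. \<Sum>v\<in>S. g v)"
    if "\<And>v. v \<in> V - \<Union>B \<Longrightarrow> g v = 0" for g :: "'a \<Rightarrow> real"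
  proof -
    have "(\<Sum>v\<in>V. g v) = (\<Sum>v\<in>\<Union>B. g v)"
      using that V \<open>(\<Union>B) \<subseteq> V\<close> by (intro sum.mono_neutral_right) auto
    also have "\<dots> = (\<Sum>S\<in>B. \<Sum>v\<in>S. g v)"
      using sum.Union_disjoint[of B g] finS B(1) by (simp add: disjoint_def)
    finally show ?thesis .
  qed
  have zeroV: "(\<Sum>v\<in>V. x v) = 0"
    using over_B[OF supp] zero by simp
  have "(\<Sum>v\<in>V. (x v)\<^sup>2) = (\<Sum>S\<in>B. \<Sum>v\<in>S. (x v)\<^sup>2)"
    by (rule over_B) (simp add: supp)
  then have "(\<Sum>S\<in>B. 2 * t * (\<Sum>v\<in>S. (x v)\<^sup>2)) = 2 * t * (\<Sum>v\<in>V. (x v)\<^sup>2)"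
    by (simp only: sum_distrib_left)
  moreover have "(\<Sum>u\<in>V. \<Sum>v\<in>V. (x u - x v)\<^sup>2) = 2 * card V * (\<Sum>v\<in>V. (x v)\<^sup>2)"
    by (simp add: sum_squared_differences zeroV)
  ultimately have "2 * (card V + t) * (\<Sum>v\<in>V. (x v)\<^sup>2) =
      (\<Sum>u\<in>V. \<Sum>v\<in>V. (x u - x v)\<^sup>2) + (\<Sum>S\<in>B. 2 * t * (\<Sum>v\<in>S. (x v)\<^sup>2))"
    by (simp add: ring_distribs)
  also have "(\<Sum>S\<in>B. 2 * t * (\<Sum>v\<in>S. (x v)\<^sup>2)) \<le> (\<Sum>S\<in>B. \<Sum>u\<in>S. \<Sum>v\<in>S. (x u - x v)\<^sup>2)"
  proof (rule sum_mono)
    fix S assume S: "S \<in> B"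
    have "real t * (\<Sum>v\<in>S. (x v)\<^sup>2) \<le> real (card S) * (\<Sum>v\<in>S. (x v)\<^sup>2)"
      using size[OF S] by (intro mult_right_mono sum_nonneg) auto
    then show "2 * t * (\<Sum>v\<in>S. (x v)\<^sup>2) \<le> (\<Sum>u\<in>S. \<Sum>v\<in>S. (x u - x v)\<^sup>2)"
      by (simp add: sum_squared_differences zero[OF S])
  qed
  also have "(\<Sum>S\<in>B. \<Sum>u\<in>S. \<Sum>v\<in>S. (x u - x v)\<^sup>2) = (\<Sum>S\<in>B. \<Sum>u\<in>V. \<Sum>v\<in>V. ?f S u v)"
  proof (rule sum.cong[OF refl])
    fix S assume S: "S \<in> B"
    have "(\<Sum>u\<in>S. \<Sum>v\<in>S. (x u - x v)\<^sup>2) = (\<Sum>(u, v)\<in>S \<times> S. (x u - x v)\<^sup>2)"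
      by (rule sum.cartesian_product)
    also have "\<dots> = (\<Sum>(u, v)\<in>V \<times> V. ?f S u v)"
      using V B(2)[OF S] by (intro sum.mono_neutral_cong_left) (auto split: if_splits)
    also have "\<dots> = (\<Sum>u\<in>V. \<Sum>v\<in>V. ?f S u v)"
      by (rule sum.cartesian_product[symmetric])
    finally show "(\<Sum>u\<in>S. \<Sum>v\<in>S. (x u - x v)\<^sup>2) = (\<Sum>u\<in>V. \<Sum>v\<in>V. ?f S u v)" .
  qed
  also have "\<dots> = (\<Sum>u\<in>V. \<Sum>v\<in>V. \<Sum>S\<in>B. ?f S u v)"
    by (subst sum.swap, rule sum.cong[OF refl], rule sum.swap)
  finally have "2 * (card V + t) * (\<Sum>v\<in>V. (x v)\<^sup>2) \<le>
      (\<Sum>u\<in>V. \<Sum>v\<in>V. (x u - x v)\<^sup>2 + (\<Sum>S\<in>B. ?f S u v))"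
    by (simp add: sum.distrib)
  also have "\<dots> \<le> (\<Sum>u\<in>V. \<Sum>v\<in>V. d u v * (x u - x v)\<^sup>2)"
  proof (intro sum_mono)
    fix u v assume uv: "u \<in> V" "v \<in> V"
    consider "u = v" | S where "u \<noteq> v" "S \<in> B" "u \<in> S" "v \<in> S"
      | "u \<noteq> v" "\<And>S. S \<in> B \<Longrightarrow> \<not> (u \<in> S \<and> v \<in> S)" by blast
    then show "(x u - x v)\<^sup>2 + (\<Sum>S\<in>B. ?f S u v) \<le> d u v * (x u - x v)\<^sup>2"
    proof cases
      case 1
      then show ?thesis by (auto intro!: sum.neutral)
    next
      case 2
      have uniq: "T = S" if "T \<in> B" "u \<in> T" for T
        using that 2 B(1) unfolding disjoint_def by blast
      have "(\<Sum>T\<in>B. ?f T u v) = (\<Sum>T\<in>B. if T = S then (x u - x v)\<^sup>2 else 0)"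
      proof (rule sum.cong[OF refl])
        fix T assume "T \<in> B"
        then have "u \<in> T \<longleftrightarrow> T = S" using uniq 2(3) by blast
        then show "?f T u v = (if T = S then (x u - x v)\<^sup>2 else 0)"
          by (cases "T = S") (simp_all only: 2(4) simp_thms if_True if_False)
      qed
      also have "\<dots> = (x u - x v)\<^sup>2" using 2 finB by simp
      finally show ?thesis
        using mult_right_mono[OF d2[OF 2(2,3,4,1)], of "(x u - x v)\<^sup>2"] by simp
    next
      case 3
      then have "(\<Sum>T\<in>B. ?f T u v) = 0" by (intro sum.neutral) auto
      then show ?thesis
        using mult_right_mono[OF d1[OF uv 3(1)], of "(x u - x v)\<^sup>2"] by simp
    qed
  qed
  finally show ?thesis by (simp add: field_simps)
qed

section \<open>Distances and the complement graph\<close>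

lemma graph_dist_sym:
  assumes "pair_graph G"
  shows "graph_dist G u v = graph_dist G v u"
proof -
  interpret pair_graph G by fact
  have len: "length (rev_path p) = length p" for p :: "('a \<times> 'a) list"
    by (induction p) auto
  have rev: "\<exists>q. apath b q a \<and> length q = k" if "\<exists>p. apath a p b \<and> length p = k" for a b k
  proof -
    from that obtain p where p: "apath a p b" "length p = k" by (elim exE conjE)
    then have "apath b (rev_path p) a \<and> length (rev_path p) = k"
      by (simp only: apath_rev_path len)
    then show ?thesis by (rule exI)
  qed
  have "(\<exists>p. apath u p v \<and> length p = k) = (\<exists>p. apath v p u \<and> length p = k)" for k
    by (rule iffI) (erule rev)+
  then show ?thesis unfolding graph_dist_def by (simp only:)
qed

lemma graph_dist_attained:
  assumes "pair_graph G" and con: "Digraph_Component.connected (with_proj G)"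
    and uv: "u \<in> pverts G" "v \<in> pverts G"
  obtains p where "pre_digraph.apath (with_proj G) u p v" "length p = graph_dist G u v"
proof -
  interpret pair_graph G by fact
  have "strongly_connected (with_proj G)"
    by (rule symmetric_connected_imp_strongly_connected[OF pair_sym_arcs con])
  then have "reachable (with_proj G) u v"
    using uv unfolding strongly_connected_def with_proj_simps by (elim conjE) (drule (1) bspec)+
  then obtain p where "apath u p v" unfolding reachable_apath by (elim exE)
  then have "\<exists>p. apath u p v \<and> length p = length p" by (intro exI conjI refl)
  then have "\<exists>k p. apath u p v \<and> length p = k" by (elim exE) (intro exI)
  from LeastI_ex[OF this] obtain q where "apath u q v" "length q = graph_dist G u v"
    unfolding graph_dist_def by (elim exE conjE)
  then show ?thesis by (rule that)
qed

lemma graph_dist_pos: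
  assumes "pair_graph G" "Digraph_Component.connected (with_proj G)"
    and uv: "u \<in> pverts G" "v \<in> pverts G" "u \<noteq> v"
  shows "1 \<le> graph_dist G u v"
proof -
  interpret pair_graph G by fact
  obtain p where p: "apath u p v" "length p = graph_dist G u v"
    using graph_dist_attained[OF assms(1,2) uv(1,2)] .
  then have "p \<noteq> []" using uv(3) by (auto simp: apath_Nil_iff)
  then show ?thesis using p(2) by (metis One_nat_def Suc_leI length_greater_0_conv)
qed

lemma graph_dist_nonadjacent:
  assumes "pair_graph G" "Digraph_Component.connected (with_proj G)"
    and uv: "u \<in> pverts G" "v \<in> pverts G" "u \<noteq> v" "(u, v) \<notin> parcs G"
  shows "2 \<le> graph_dist G u v"
proof (rule ccontr)
  interpret pair_graph G by fact
  assume "\<not> ?thesis"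
  then have "graph_dist G u v = 1" using graph_dist_pos[OF assms(1-5)] by simp
  then obtain p where "apath u p v" "length p = 1"
    using graph_dist_attained[OF assms(1,2) uv(1,2)] by metis
  then obtain e where "apath u [e] v" by (auto simp: length_Suc_conv)
  then have "e = (u, v)" "e \<in> parcs G"
    by (auto simp: apath_def awalk_simps prod_eq_iff)
  then show False using uv(4) by simp
qed

lemma graph_dist_adjacent:
  assumes "pair_graph G" "Digraph_Component.connected (with_proj G)"
    and e: "(u, v) \<in> parcs G"
  shows "graph_dist G u v = 1"
proof (rule antisym)
  interpret pair_graph G by fact
  have uv: "u \<in> pverts G" "v \<in> pverts G" "u \<noteq> v"
    using e wellformed' pair_no_loops[OF e] by auto
  then have "apath u [(u, v)] v"
    using e by (auto simp: apath_def awalk_simps)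
  then show "graph_dist G u v \<le> 1"
    unfolding graph_dist_def by (intro Least_le) auto
  show "1 \<le> graph_dist G u v" by (rule graph_dist_pos[OF assms(1,2) uv])
qed

lemma pair_graph_complement:
  assumes "pair_graph G"
  shows "pair_graph (complement_graph G)"
proof -
  interpret pair_graph G by fact
  have "finite (pverts G \<times> pverts G)" by simp
  then have "finite (parcs (complement_graph G))"
    by (rule finite_subset[rotated]) (auto simp: complement_graph_def)
  moreover have "symmetric (with_proj (complement_graph G))"
    using arcs_symmetric by (auto simp: symmetric_def sym_def complement_graph_def)
  ultimately show ?thesis
    by unfold_locales (auto simp: complement_graph_def)
qed

section \<open>Eigenvalue counts of the distance Laplacian\<close>

lemma distance_laplacian_form_matrix:
  assumes vs: "distinct vs" "set vs = pverts G"
  shows "distance_laplacian G vs = form_matrix (\<lambda>u v.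
    (if u = v then \<Sum>w\<in>pverts G. real (graph_dist G w u) else 0) - real (graph_dist G u v)) vs"
  unfolding distance_laplacian_def form_matrix_def distance_matrix_def mat_diag_def
  by (rule eq_matI) (use vs(1) in \<open>auto simp: nth_eq_iff_index_eq transmission_def\<close>)

text \<open>
  The right end of the interval excludes no eigenvalue.
\<close>

lemma dl_count_up_to_largest:
  "dl_count G vs {s..dl_eigenvalue G vs 1} =
    size {#x \<in># proots (char_poly (distance_laplacian G vs)). s \<le> x#}"
proof -
  let ?xs = "sorted_list_of_multiset (dl_eigenvalues G vs)"
  have "x \<le> dl_eigenvalue G vs 1" if "x \<in># dl_eigenvalues G vs" for x
  proof -
    have x: "x \<in> set ?xs" using that by simp
    then have "?xs \<noteq> []" by (intro notI) (simp only: list.set empty_iff)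
    then have "dl_eigenvalue G vs 1 = last ?xs"
      by (simp add: dl_eigenvalue_def rev_nth last_conv_nth)
    moreover have xs: "butlast ?xs @ [last ?xs] = ?xs"
      using \<open>?xs \<noteq> []\<close> by (rule append_butlast_last_id)
    have "sorted (butlast ?xs @ [last ?xs])" unfolding xs by simp
    moreover have "x \<in> set (butlast ?xs @ [last ?xs])" unfolding xs by (rule x)
    ultimately show ?thesis by (auto simp: sorted_append)
  qed
  then have "filter_mset (\<lambda>x. x \<in> {s..dl_eigenvalue G vs 1}) (dl_eigenvalues G vs) =
      filter_mset (\<lambda>x. s \<le> x) (dl_eigenvalues G vs)"
    by (intro filter_mset_cong) auto
  then show ?thesis by (simp add: dl_count_def dl_eigenvalues_def)
qed

text \<open>
  The functions that are constant on the components of the complement are cut out by one equation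
  \<open>x u = x (rep u)\<close> for each vertex \<open>u\<close> that is not the chosen representative of its component.
\<close>

lemma dl_count_upper_bound:
  fixes G :: "'a pair_pre_digraph" and t :: nat
  assumes G: "pair_graph G" "Digraph_Component.connected (with_proj G)"
    and vs: "distinct vs" "set vs = pverts G" and t: "1 \<le> t"
  defines "n \<equiv> card (pverts G)"
  shows "dl_count G vs {real (n + t)..dl_eigenvalue G vs 1} + num_components (complement_graph G) \<le> n"
proof -
  interpret G: pair_graph G by fact
  let ?H = "complement_graph G"
  interpret H: pair_graph ?H by (rule pair_graph_complement[OF G(1)])
  let ?V = "pverts G" and ?d = "\<lambda>u v. real (graph_dist G u v)"
  have VH: "pverts ?H = ?V" by (simp add: complement_graph_def)
  have fin: "finite ?V" by simp
  define rep where "rep u = (SOME v. v \<in> H.scc_of u)" for u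
  have rep_in: "rep u \<in> H.scc_of u" if "u \<in> ?V" for u
    unfolding rep_def using H.in_scc_of_self[of u] that VH by (metis someI_ex)
  have rep_V: "rep u \<in> ?V" if "u \<in> ?V" for u
    using rep_in[OF that] VH by (auto simp: H.scc_of_def dest: H.reachable_in_verts)
  have rep_scc: "H.scc_of (rep u) = H.scc_of u" if "u \<in> ?V" for u
    using rep_in[OF that] by (auto simp: H.scc_of_def intro: H.reachable_trans)
  define R where "R = rep ` ?V"
  have "num_components ?H = card H.sccs_verts"
    by (simp add: num_components_def H.card_sccs_verts)
  also have "H.sccs_verts = H.scc_of ` R"
    using rep_scc by (auto simp: H.sccs_verts_conv_scc_of VH R_def image_iff)
  also have "card \<dots> \<le> card R"
    using fin by (simp add: R_def card_image_le)
  finally have comps: "num_components ?H \<le> card R" .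
  define a where "a u v = (if v = u then 1 else 0) - (if v = rep u then 1 else (0::real))" for u v
  have form: "(\<Sum>u\<in>set vs. \<Sum>v\<in>set vs.
        ((if u = v then \<Sum>w\<in>?V. ?d w u else 0) - ?d u v) * x u * x v)
      \<le> real n * (\<Sum>v\<in>set vs. (x v)\<^sup>2)"
    if x: "\<forall>u\<in>?V - R. (\<Sum>v\<in>set vs. a u v * x v) = 0" for x
  proof -
    have x_rep: "x u = x (rep u)" if u: "u \<in> ?V" for u
    proof (cases "u \<in> R")
      case True
      then obtain w where "w \<in> ?V" "u = rep w" by (auto simp: R_def)
      then have "rep u = u" using rep_scc[of w] by (simp add: rep_def)
      then show ?thesis by simp
    next
      case False
      have "(\<Sum>v\<in>?V. a u v * x v) = (\<Sum>v\<in>?V. (if v = u then x v else 0) - (if v = rep u then x v else 0))"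
        by (intro sum.cong) (auto simp: a_def)
      also have "\<dots> = x u - x (rep u)"
        using fin u rep_V[OF u] by (simp add: sum_subtractf)
      finally show ?thesis using x u False vs(2) by simp
    qed
    \<comment> \<open>Only pairs in different components matter, and these are adjacent in the graph.\<close>
    have "?d u v * (x u - x v)\<^sup>2 = (x u - x v)\<^sup>2" if uv: "u \<in> ?V" "v \<in> ?V" for u v
    proof (cases "H.scc_of u = H.scc_of v")
      case True
      then have "x u = x v" using x_rep[OF uv(1)] x_rep[OF uv(2)] by (simp add: rep_def)
      then show ?thesis by simp
    next
      case False
      have "(u, v) \<notin> parcs ?H"
      proof
        assume "(u, v) \<in> parcs ?H"
        then have "(u, v) \<in> parcs ?H" "(v, u) \<in> parcs ?H"
          using H.arcs_symmetric by auto
        then have "H.scc_of u = H.scc_of v"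
          unfolding H.scc_of_def by (meson H.reachable_adjI H.reachable_trans)
        then show False using \<open>H.scc_of u \<noteq> H.scc_of v\<close> by simp
      qed
      then have "(u, v) \<in> parcs G"
        using uv False by (auto simp: complement_graph_def)
      then show ?thesis using graph_dist_adjacent[OF G] by simp
    qed
    then have "(\<Sum>u\<in>?V. \<Sum>v\<in>?V. ?d u v * (x u - x v)\<^sup>2) = (\<Sum>u\<in>?V. \<Sum>v\<in>?V. (x u - x v)\<^sup>2)"
      by (intro sum.cong refl)
    then have "(\<Sum>u\<in>?V. \<Sum>v\<in>?V. ?d u v * (x u - x v)\<^sup>2) / 2 =
        real n * (\<Sum>v\<in>?V. (x v)\<^sup>2) - (\<Sum>v\<in>?V. x v)\<^sup>2"
      by (simp add: sum_squared_differences n_def)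
    also have "\<dots> \<le> real n * (\<Sum>v\<in>?V. (x v)\<^sup>2)" by simp
    finally show ?thesis
      using laplacian_quadratic_form[of ?V ?d x] graph_dist_sym[OF G(1)] fin
      by (simp add: vs(2))
  qed
  have "size {#x \<in># proots (char_poly (distance_laplacian G vs)). real (n + t) \<le> x#} \<le> card (?V - R)"
    unfolding distance_laplacian_form_matrix[OF vs]
    by (rule few_large_eigenvalues[where a = a and r = "real n"])
       (use vs(1) t fin form graph_dist_sym[OF G(1)] in auto)
  also have "\<dots> = n - card R"
    using fin rep_V unfolding n_def by (intro card_Diff_subset) (auto simp: R_def)
  finally have "dl_count G vs {real (n + t)..dl_eigenvalue G vs 1} \<le> n - card R"
    unfolding dl_count_up_to_largest .
  moreover have "card R \<le> n"
    using fin by (simp add: R_def n_def card_image_le)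
  ultimately show ?thesis using comps by linarith
qed

text \<open>
  The equations say that \<open>x\<close> vanishes at each vertex outside \<open>\<Union>B\<close> (left summand of the index set) and has
  sum zero on each member of \<open>B\<close> (right summand). Their number is \<open>n - card (\<Union>B) + card B\<close>.
\<close>

lemma dl_count_lower_bound:
  fixes G :: "'a pair_pre_digraph" and t :: nat
  assumes G: "pair_graph G" "Digraph_Component.connected (with_proj G)"
    and vs: "distinct vs" "set vs = pverts G"
    and B: "disjoint B" "\<And>S. S \<in> B \<Longrightarrow> independent_set G S" "\<And>S. S \<in> B \<Longrightarrow> t \<le> card S"
  defines "n \<equiv> card (pverts G)"
  shows "(\<Sum>S\<in>B. card S) \<le> card B + dl_count G vs {real (n + t)..dl_eigenvalue G vs 1}"
proof -
  interpret G: pair_graph G by fact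
  let ?V = "pverts G" and ?d = "\<lambda>u v. real (graph_dist G u v)"
  have fin: "finite ?V" by simp
  have BV: "S \<subseteq> ?V" if "S \<in> B" for S using B(2)[OF that] by (simp add: independent_set_def)
  then have UV: "\<Union>B \<subseteq> ?V" by blast
  have "B \<subseteq> Pow ?V" using BV by auto
  then have finB: "finite B" using fin by (simp add: finite_subset)
  define I where "I = (?V - \<Union>B) <+> B"
  define a :: "'a + 'a set \<Rightarrow> 'a \<Rightarrow> real" where "a = case_sum (\<lambda>u v. if v = u then 1 else 0) (\<lambda>S v. if v \<in> S then 1 else 0)"
  have form: "real (n + t) * (\<Sum>v\<in>set vs. (x v)\<^sup>2) \<le> (\<Sum>u\<in>set vs. \<Sum>v\<in>set vs.
        ((if u = v then \<Sum>w\<in>?V. ?d w u else 0) - ?d u v) * x u * x v)"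
    if x: "\<forall>i\<in>I. (\<Sum>v\<in>set vs. a i v * x v) = 0" for x
  proof -
    have supp: "x u = 0" if u: "u \<in> ?V - \<Union>B" for u
    proof -
      have "(\<Sum>v\<in>?V. a (Inl u) v * x v) = (\<Sum>v\<in>?V. if v = u then x v else 0)"
        by (intro sum.cong) (auto simp: a_def)
      also have "\<dots> = x u" using fin u by simp
      finally show ?thesis using bspec[OF x, of "Inl u"] u vs(2) by (simp add: I_def InlI)
    qed
    have zero: "(\<Sum>v\<in>S. x v) = 0" if S: "S \<in> B" for S
    proof -
      have "(\<Sum>v\<in>?V. a (Inr S) v * x v) = (\<Sum>v\<in>S. x v)"
        using fin BV[OF S] by (intro sum.mono_neutral_cong_right) (auto simp: a_def)
      then show ?thesis using bspec[OF x, of "Inr S"] S vs(2) by (simp add: I_def InrI)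
    qed
    have "real (card ?V + t) * (\<Sum>v\<in>?V. (x v)\<^sup>2) \<le> (\<Sum>u\<in>?V. \<Sum>v\<in>?V. ?d u v * (x u - x v)\<^sup>2) / 2"
    proof (rule form_on_independent_classes[OF fin B(1) BV])
      show "1 \<le> ?d u v" if "u \<in> ?V" "v \<in> ?V" "u \<noteq> v" for u v
        using graph_dist_pos[OF G that] by simp
      show "2 \<le> ?d u v" if "S \<in> B" "u \<in> S" "v \<in> S" "u \<noteq> v" for S u v
        using graph_dist_nonadjacent[OF G, of u v] B(2)[of S] that by (auto simp: independent_set_def)
    qed (use B(3) supp zero in auto)
    then show ?thesis
      using laplacian_quadratic_form[of ?V ?d x] graph_dist_sym[OF G(1)] fin
      by (simp add: vs(2) n_def)
  qed
  have "length vs \<le> card I +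
      size {#x \<in># proots (char_poly (distance_laplacian G vs)). real (n + t) \<le> x#}"
    unfolding distance_laplacian_form_matrix[OF vs]
    by (rule many_large_eigenvalues[where a = a])
       (use vs(1) fin finB form graph_dist_sym[OF G(1)] in \<open>auto simp: I_def\<close>)
  moreover have "card I = n - card (\<Union>B) + card B"
    using fin finB UV by (simp add: I_def card_Plus card_Diff_subset finite_subset n_def)
  moreover have "card (\<Union>B) \<le> n" using fin UV by (simp add: n_def card_mono)
  moreover have "length vs = n" using distinct_card[OF vs(1)] vs(2) by (simp add: n_def)
  moreover have "card (\<Union>B) = (\<Sum>S\<in>B. card S)"
    using B(1) finite_subset[OF BV fin]
    by (intro card_Union_disjoint) (auto simp: disjoint_def pairwise_def disjnt_def)
  ultimately show ?thesis unfolding dl_count_up_to_largest by linarith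
qed

theorem corollary6p5:
  fixes G :: "'a pair_pre_digraph" and vs :: "'a list" and n :: nat
  assumes "pair_graph G"
    and "Digraph_Component.connected (with_proj G)"
    and "distinct vs" and "set vs = pverts G"
    and "n = card (pverts G)"
  shows
    "(\<forall>t::nat. t \<ge> 1 \<longrightarrow>
        int (dl_count G vs {real (n + t)..dl_eigenvalue G vs 1})
          \<le> int n - int (num_components (complement_graph G))) \<and>
     (\<forall>(P :: 'a set set) (C :: nat \<Rightarrow> 'a set) (l :: nat \<Rightarrow> nat) \<chi>.
        \<chi> = chromatic_number G \<and> proper_coloring G P \<and> card P = \<chi> \<and>
        bij_betw C {1..\<chi>} P \<and> (\<forall>j\<in>{1..\<chi>}. l j = card (C j)) \<and>
        (\<forall>i\<in>{1..\<chi>}. \<forall>j\<in>{1..\<chi>}. i \<le> j \<longrightarrow> l j \<le> l i) \<longrightarrow>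
        (\<forall>t::nat. t \<ge> 2 \<longrightarrow>
          (\<Sum>j | 1 \<le> j \<and> j \<le> \<chi> \<and> l j \<ge> t. int (l j) - 1)
            \<le> int (dl_count G vs {real (n + t)..dl_eigenvalue G vs 1}) \<and>
          int (dl_count G vs {real (n + t)..dl_eigenvalue G vs 1})
            \<le> int n - int (num_components (complement_graph G))))"
proof -
  have upper: "int (dl_count G vs {real (n + t)..dl_eigenvalue G vs 1})
      \<le> int n - int (num_components (complement_graph G))" if "1 \<le> t" for t :: nat
    using dl_count_upper_bound[OF assms(1-4) that] unfolding assms(5) by linarith
  have lower: "(\<Sum>j | 1 \<le> j \<and> j \<le> \<chi> \<and> l j \<ge> t. int (l j) - 1)
      \<le> int (dl_count G vs {real (n + t)..dl_eigenvalue G vs 1})"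
    if P: "proper_coloring G P" and C: "bij_betw C {1..\<chi>} P"
      and l: "\<forall>j\<in>{1..\<chi>}. l j = card (C j)"
    for P :: "'a set set" and C :: "nat \<Rightarrow> 'a set" and l :: "nat \<Rightarrow> nat" and \<chi> t :: nat
  proof -
    define J where "J = {j. 1 \<le> j \<and> j \<le> \<chi> \<and> t \<le> l j}"
    have J: "J \<subseteq> {1..\<chi>}" by (auto simp: J_def)
    have inj: "inj_on C J" using C J by (meson bij_betw_def inj_on_subset)
    have CP: "C ` J \<subseteq> P" using C J by (auto simp: bij_betw_def)
    have "(\<Sum>j\<in>J. int (l j) - 1) = (\<Sum>j\<in>J. int (card (C j))) - int (card J)"
      using l J by (simp add: sum_subtractf subset_iff)
    also have "\<dots> = int (\<Sum>S\<in>C ` J. card S) - int (card (C ` J))"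
      by (simp add: sum.reindex[OF inj] card_image[OF inj])
    also have "\<dots> \<le> int (dl_count G vs {real (n + t)..dl_eigenvalue G vs 1})"
    proof -
      have "disjoint (C ` J)"
        using P CP by (meson disjoint_def partition_on_def proper_coloring_def subset_iff)
      moreover have "independent_set G S" if "S \<in> C ` J" for S
        using P CP that by (auto simp: proper_coloring_def)
      moreover have "t \<le> card S" if "S \<in> C ` J" for S
        using that l J by (auto simp: J_def)
      ultimately have "(\<Sum>S\<in>C ` J. card S) \<le> card (C ` J) +
          dl_count G vs {real (n + t)..dl_eigenvalue G vs 1}"
        unfolding assms(5) by (rule dl_count_lower_bound[OF assms(1-4)])
      then show ?thesis by linarith
    qed
    finally show ?thesis unfolding J_def .
  qed
  show ?thesis
    using upper lower by auto
qed

end
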